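(* There exists an absolute constant $c>0$ such that for every integer $N\ge 2$, $$\int_0^1\left|\sum_{p\le N} e(p\alpha)\right|\,d\alpha\;\ge\; c\,\frac{N^{1/2}}{(\log N)^2},$$ where the sum is over primes $p\le N$.
   Context: For real $x$, $e(x)=e^{2\pi i x}$. *)

theory Defs
  imports "HOL-Analysis.Analysis" "HOL-Computational_Algebra.Primes"
begin

definition add_char :: "real \<Rightarrow> complex" where
  "add_char x = exp (2 * of_real pi * \<i> * of_real x)"

end

theory Submission
  imports Defs "HOL-Real_Asymp.Real_Asymp"
begin

text \<open>Write \<open>S\<close> for the sum and let \<open>Q = \<lfloor>\<surd>N\<rfloor>\<close>. For a prime \<open>q\<close> the Ramanujan sum over
  \<open>1 \<le> a < q\<close> of \<open>e(pa/q)\<close> is \<open>-1\<close> at every prime \<open>p \<noteq> q\<close>. Hence adding up \<open>S(\<beta> + a/q)\<close> over all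
  fractions \<open>a/q\<close> with prime \<open>q \<le> Q\<close> gives \<open>-\<pi>(Q) S(\<beta>)\<close> up to an error of at most \<open>Q \<pi>(Q)\<close>. When
  \<open>\<bar>\<beta>\<bar> \<le> 1/(8N)\<close> the terms of \<open>S(\<beta>)\<close> all point roughly in the same direction, so
  \<open>\<bar>S(\<beta>)\<bar> \<ge> \<pi>(N)/2\<close>. The arcs of radius \<open>1/(8N)\<close> around the fractions are disjoint because
  \<open>Q\<^sup>2 \<le> N\<close>, so integrating over \<open>\<beta>\<close> bounds the norm below by \<open>\<pi>(Q) (\<pi>(N)/2 - Q) / (4N)\<close>, and
  Chebyshev's lower bound for \<open>\<pi>\<close> concludes. For small \<open>N\<close> the norm is at least \<open>1\<close>, the Fourier
  coefficient at the prime \<open>2\<close>.\<close>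

definition primes_upto :: "nat \<Rightarrow> nat set" where
  "primes_upto n = {p. prime p \<and> p \<le> n}"

lemma finite_primes_upto [simp]: "finite (primes_upto n)"
  unfolding primes_upto_def by (rule finite_subset[of _ "{..n}"]) auto

section \<open>A Chebyshev lower bound\<close>

text \<open>The witness is the least common multiple of 1, ..., m: each prime \<open>p\<close> \<le>
  \<open>m\<close> enters with its largest power not exceeding \<open>m\<close>, so each of the
  \<pi>(m) factors is at most \<open>m\<close>.\<close>

lemma common_multiple_le_power_card_primes:
  fixes m :: nat
  assumes "m \<ge> 1"
  obtains D :: nat where "D > 0" "\<And>i. 1 \<le> i \<Longrightarrow> i \<le> m \<Longrightarrow> i dvd D"
    "D \<le> m ^ card (primes_upto m)"
proof -
  define e where "e p = (GREATEST v. p ^ v \<le> m)" for p :: nat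
  \<comment> \<open>Bounding the admissible exponents is what makes \<open>GREATEST\<close>
    meaningful; the exponent 0 is admissible since \<open>m\<close> \<ge> 1.\<close>
  have bound: "v \<le> m" if "prime p" "p ^ v \<le> m" for p v :: nat
  proof -
    have "v < 2 ^ v" by (rule less_exp)
    also have "2 ^ v \<le> p ^ v"
      using prime_ge_2_nat[OF that(1)] by (intro power_mono) auto
    finally show ?thesis using that by simp
  qed
  have e_le: "p ^ e p \<le> m" if "prime p" for p :: nat
    unfolding e_def
    by (rule GreatestI_nat[where P = "\<lambda>v. p ^ v \<le> m" and k = 0 and b = m])
       (use bound[OF that] assms in auto)
  have e_ge: "v \<le> e p" if "prime p" "p ^ v \<le> m" for p v :: nat
    unfolding e_def
    by (rule Greatest_le_nat[where P = "\<lambda>v. p ^ v \<le> m" and b = m])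
       (use bound[OF that(1)] that in auto)
  define D where "D = (\<Prod>p\<in>primes_upto m. p ^ e p)"
  have D_pos: "D > 0"
    unfolding D_def by (intro prod_pos) (auto simp: primes_upto_def prime_gt_0_nat)
  have "D \<le> (\<Prod>p\<in>primes_upto m. m)"
    unfolding D_def by (intro prod_mono) (auto simp: primes_upto_def e_le)
  then have D_le: "D \<le> m ^ card (primes_upto m)" by simp
  have "i dvd D" if i: "1 \<le> i" "i \<le> m" for i
  proof (rule multiplicity_le_imp_dvd)
    show "i \<noteq> 0" using i by simp
    fix p :: nat assume p: "prime p"
    show "multiplicity p i \<le> multiplicity p D"
    proof (cases "p dvd i")
      case False
      then show ?thesis by (simp add: not_dvd_imp_multiplicity_0)
    next
      case True
      with i have "p \<le> m" by (meson dvd_imp_le le_trans less_le_trans zero_less_one)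
      then have "p ^ e p dvd D"
        unfolding D_def using p by (intro dvd_prodI) (auto simp: primes_upto_def)
      then have "e p \<le> multiplicity p D"
        using p D_pos by (subst (asm) power_dvd_iff_le_multiplicity) auto
      moreover have "p ^ multiplicity p i \<le> m"
        using i by (meson dvd_imp_le le_trans less_le_trans multiplicity_dvd zero_less_one)
      ultimately show ?thesis using e_ge[OF p] le_trans by blast
    qed
  qed
  with D_pos D_le show ?thesis using that by blast
qed

text \<open>The induction is along the rows of Leibniz's harmonic triangle, whose entries
  \<open>1 / (k * (n choose k))\<close> satisfy a subtractive Pascal rule.\<close>

lemma times_binomial_dvd_common_multiple:
  fixes D m :: nat
  assumes dvd: "\<And>i. 1 \<le> i \<Longrightarrow> i \<le> m \<Longrightarrow> i dvd D"
    and "k \<ge> 1" "k + j \<le> m"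
  shows "real D / (real k * real ((k + j) choose k)) \<in> \<int>"
  using assms(2,3)
proof (induction j arbitrary: k)
  case 0
  then obtain t where "D = k * t" using dvd[of k] by (auto elim: dvdE)
  then show ?case using 0 by simp
next
  case (Suc j)
  define C where "C = real ((k + j) choose k)"
  have C: "C > 0" by (simp add: C_def)
  have "(k + 1) * ((k + 1 + j) choose (k + 1)) = (k + j + 1) * ((k + j) choose k)"
    using Suc_times_binomial[of k "k + j"] by simp
  from arg_cong[OF this, of real]
  have 1: "real (k + 1) * real ((k + 1 + j) choose (k + 1)) = (real k + real j + 1) * C"
    by (simp add: C_def algebra_simps del: binomial_Suc_Suc)
  have "(Suc (k + j) - k) * (Suc (k + j) choose k) = Suc (k + j) * ((k + j) choose k)"
    using binomial_absorb_comp[of "Suc (k + j)" k] by simp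
  from arg_cong[OF this, of real]
  have 2: "(real j + 1) * real ((k + Suc j) choose k) = (real k + real j + 1) * C"
    by (simp add: C_def algebra_simps)
  then have 2: "real ((k + Suc j) choose k) = (real k + real j + 1) * C / (real j + 1)"
    by (simp add: field_simps)
  \<comment> \<open>With \<open>C\<close> = (k+j choose k), the two absorption identities turn the
    entries at (k, j) and (k+1, j) into 1/(k C) and 1/((k+j+1) C); their difference is the entry at
    (k, j+1).\<close>
  have "real D / (real k * real ((k + Suc j) choose k)) =
        real D / (real k * C) - real D / ((real k + real j + 1) * C)"
    unfolding 2 using C Suc.prems by (simp add: divide_simps) (simp add: algebra_simps)
  also have "\<dots> \<in> \<int>"
    using Suc.IH[of k] Suc.IH[of "k + 1"] Suc.prems unfolding 1 C_def[symmetric]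
    by (intro Ints_diff) auto
  finally show ?case .
qed

text \<open>A positive integer is at least 1, so integrality of \<open>D\<close> / (n (2n choose n))
  forces \<open>D\<close> \<ge> n (2n choose n) \<ge> 4^n / 2 \<ge> 2^n, while \<open>D\<close> is
  at most m^\<pi>(m).\<close>

lemma two_power_le_power_card_primes:
  assumes "n \<ge> 1" "2 * n \<le> m"
  shows "(2::real) ^ n \<le> real m ^ card (primes_upto m)"
proof -
  obtain D :: nat where D: "D > 0" "\<And>i. 1 \<le> i \<Longrightarrow> i \<le> m \<Longrightarrow> i dvd D"
    "D \<le> m ^ card (primes_upto m)"
    using common_multiple_le_power_card_primes[of m] assms by auto
  define B where "B = real n * real ((2 * n) choose n)"
  have B: "B > 0" using assms by (simp add: B_def)
  have "real D / B \<in> \<int>"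
    using times_binomial_dvd_common_multiple[of m D n n] D assms
    by (simp add: B_def mult_2)
  moreover have "real D / B > 0" using D B by simp
  ultimately have "real D / B \<ge> 1"
    by (metis Ints_cases of_int_0_less_iff of_int_1_le_iff int_one_le_iff_zero_less)
  then have "B \<le> real D" using B by (simp add: field_simps)
  have "(2::real) ^ n * 2 \<le> 2 ^ n * 2 ^ n"
    using assms by (intro mult_left_mono self_le_power[of 2]) auto
  then have "(2::real) ^ n \<le> 4 ^ n / 2"
    by (simp flip: power_mult_distrib)
  also have "\<dots> \<le> B"
    using central_binomial_lower_bound[of n] assms by (simp add: B_def field_simps)
  also note \<open>B \<le> real D\<close>
  also have "real D \<le> real m ^ card (primes_upto m)"
    using D(3) by (metis of_nat_le_iff of_nat_power)
  finally show ?thesis .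
qed

lemma card_primes_upto_ge:
  assumes "m \<ge> 2"
  shows "real (card (primes_upto m)) \<ge> real m / (6 * ln (real m))"
proof -
  have ln2: "ln 2 \<ge> (1/2 :: real)" using ln2_ge_two_thirds by simp
  have "real (m div 2) * ln 2 = ln (2 ^ (m div 2))" by (simp add: ln_realpow)
  also have "\<dots> \<le> ln (real m ^ card (primes_upto m))"
    using two_power_le_power_card_primes[of "m div 2" m] assms by (subst ln_le_cancel_iff) auto
  also have "\<dots> = real (card (primes_upto m)) * ln (real m)"
    using assms by (simp add: ln_realpow)
  finally have "real (m div 2) * ln 2 \<le> real (card (primes_upto m)) * ln (real m)" .
  \<comment> \<open>Source of the constant 6: \<open>m div 2\<close> \<ge> m/3, with equality at m =
    3, and ln 2 \<ge> 1/2.\<close>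
  moreover have "real m / 3 * (1/2) \<le> real (m div 2) * ln 2"
  proof (intro mult_mono ln2)
    have "m \<le> 3 * (m div 2)" using assms by presburger
    then show "real m / 3 \<le> real (m div 2)" by linarith
  qed auto
  ultimately have "real m / 6 \<le> real (card (primes_upto m)) * ln (real m)" by simp
  moreover have "ln (real m) > 0" using assms by simp
  ultimately show ?thesis by (simp add: field_simps)
qed

section \<open>The exponential sum near prime-denominator fractions\<close>

lemma add_char_add: "add_char (x + y) = add_char x * add_char y"
  by (simp add: add_char_def distrib_left exp_add)

lemma add_char_of_nat_mult: "add_char (real n * x) = add_char x ^ n"
  by (simp add: add_char_def exp_of_nat_mult[symmetric] mult_ac)

lemma norm_add_char [simp]: "norm (add_char x) = 1"
  by (simp add: add_char_def norm_exp)

lemma Re_add_char: "Re (add_char x) = cos (2 * pi * x)"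
  by (simp add: add_char_def Re_exp)

lemma continuous_on_add_char [continuous_intros]:
  "continuous_on S f \<Longrightarrow> continuous_on S (\<lambda>x. add_char (f x))"
  unfolding add_char_def by (intro continuous_intros)

definition prime_exp_sum :: "nat \<Rightarrow> real \<Rightarrow> complex" where
  "prime_exp_sum N x = (\<Sum>p\<in>primes_upto N. add_char (real p * x))"

lemma continuous_on_prime_exp_sum: "continuous_on S (prime_exp_sum N)"
  unfolding prime_exp_sum_def by (intro continuous_intros)

text \<open>The number \<open>z\<close> = e(p/q) is a q-th root of unity, equal to 1 only when q
  divides p, that is p = q. The full geometric sum is thus q or 0, and dropping the term a = 0
  subtracts 1.\<close>

lemma ramanujan_sum_prime:
  assumes "prime p" "prime q"
  shows "(\<Sum>a\<in>{1..<q}. add_char (real p * (real a / real q))) =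
         (if p = q then of_nat q else 0) - 1"
proof -
  define z where "z = add_char (real p / real q)"
  have q: "q \<ge> 1" using assms prime_ge_1_nat by blast
  have z: "z = exp (2 * of_real pi * \<i> * of_nat p / of_nat q)"
    by (simp add: z_def add_char_def)
  have "z ^ q = 1"
    unfolding z_def add_char_of_nat_mult[symmetric] using q by (auto simp: add_char_def exp_eq_1 intro: exI[of _ "int p"])
  have z1: "z = 1 \<longleftrightarrow> p = q"
    unfolding z using complex_root_unity_eq_1[OF q] assms primes_dvd_imp_eq by auto
  have "(\<Sum>a\<in>{..<q}. z ^ a) = (if p = q then of_nat q else 0)"
  proof (cases "p = q")
    case True
    then show ?thesis using z1 by simp
  next
    case False
    then show ?thesis using z1 \<open>z ^ q = 1\<close> by (simp add: geometric_sum)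
  qed
  moreover have "{..<q} = insert 0 {1..<q}" using q by auto
  ultimately have "(\<Sum>a\<in>{1..<q}. z ^ a) = (if p = q then of_nat q else 0) - 1"
    by (simp add: algebra_simps)
  then show ?thesis by (simp add: z_def add_char_of_nat_mult[symmetric] mult_ac)
qed

text \<open>Fractions are kept as pairs (denominator, numerator), so that a sum over them splits
  into an outer sum over \<open>q\<close> and an inner Ramanujan sum over \<open>a\<close>.\<close>

definition prime_fractions :: "nat \<Rightarrow> (nat \<times> nat) set" where
  "prime_fractions Q = (SIGMA q:primes_upto Q. {1..<q})"

lemma finite_prime_fractions [simp]: "finite (prime_fractions Q)"
  unfolding prime_fractions_def by auto

lemma sum_prime_exp_sum_fractions:
  assumes "Q \<le> N"
  shows "(\<Sum>(q, a)\<in>prime_fractions Q. prime_exp_sum N (\<beta> + real a / real q)) =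
    (\<Sum>q\<in>primes_upto Q. of_nat q * add_char (real q * \<beta>))
      - of_nat (card (primes_upto Q)) * prime_exp_sum N \<beta>"
proof -
  have "(\<Sum>(q, a)\<in>prime_fractions Q. prime_exp_sum N (\<beta> + real a / real q)) =
    (\<Sum>q\<in>primes_upto Q. \<Sum>a\<in>{1..<q}. \<Sum>p\<in>primes_upto N.
       add_char (real p * \<beta>) * add_char (real p * (real a / real q)))"
    unfolding prime_fractions_def prime_exp_sum_def
    by (subst sum.Sigma[symmetric]) (auto simp: distrib_left add_char_add)
  also have "\<dots> = (\<Sum>q\<in>primes_upto Q. \<Sum>p\<in>primes_upto N.
       add_char (real p * \<beta>) * (\<Sum>a\<in>{1..<q}. add_char (real p * (real a / real q))))"
    by (subst sum.swap) (simp add: sum_distrib_left)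
  also have "\<dots> = (\<Sum>q\<in>primes_upto Q. \<Sum>p\<in>primes_upto N.
       (if p = q then of_nat q * add_char (real q * \<beta>) else 0) - add_char (real p * \<beta>))"
    by (intro sum.cong refl, subst ramanujan_sum_prime)
       (auto simp: primes_upto_def algebra_simps)
  also have "\<dots> = (\<Sum>q\<in>primes_upto Q. of_nat q * add_char (real q * \<beta>) - prime_exp_sum N \<beta>)"
  proof (intro sum.cong refl)
    fix q assume "q \<in> primes_upto Q"
    \<comment> \<open>Here \<open>Q\<close> \<le> \<open>N\<close> matters: the diagonal term p = q
      must actually occur in the sum over p \<le> N.\<close>
    then have "q \<in> primes_upto N" using assms by (auto simp: primes_upto_def)
    then show "(\<Sum>p\<in>primes_upto N. (if p = q then of_nat q * add_char (real q * \<beta>) else 0)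
          - add_char (real p * \<beta>)) =
        of_nat q * add_char (real q * \<beta>) - prime_exp_sum N \<beta>"
      by (simp add: sum_subtractf prime_exp_sum_def)
  qed
  finally show ?thesis by (simp add: sum_subtractf)
qed

text \<open>Every phase 2 \<pi> p \<beta> is at most \<pi>/4 in absolute value, hence below \<pi>/3,
  where the cosine is 1/2; the real parts therefore add up without cancellation.\<close>

lemma norm_prime_exp_sum_near_0:
  assumes "N \<ge> 1" "\<bar>\<beta>\<bar> \<le> 1 / (8 * real N)"
  shows "norm (prime_exp_sum N \<beta>) \<ge> real (card (primes_upto N)) / 2"
proof -
  have "1 / 2 \<le> cos (2 * pi * (real p * \<beta>))" if "p \<in> primes_upto N" for p
  proof -
    have "real p * \<bar>\<beta>\<bar> \<le> real N * (1 / (8 * real N))"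
      using that assms by (intro mult_mono) (auto simp: primes_upto_def)
    then have *: "\<bar>real p * \<beta>\<bar> \<le> 1 / 8" using assms by (simp add: abs_mult)
    have "\<bar>2 * pi * (real p * \<beta>)\<bar> = 2 * pi * \<bar>real p * \<beta>\<bar>" by (simp add: abs_mult)
    also have "\<dots> \<le> 2 * pi * (1 / 8)" using * by (intro mult_left_mono) auto
    also have "\<dots> \<le> pi / 3" by simp
    finally have "cos (pi / 3) \<le> cos \<bar>2 * pi * (real p * \<beta>)\<bar>"
      by (subst cos_mono_le_eq) auto
    then show ?thesis by (simp add: cos_60)
  qed
  then have "(\<Sum>p\<in>primes_upto N. 1 / 2) \<le> Re (prime_exp_sum N \<beta>)"
    unfolding prime_exp_sum_def Re_sum Re_add_char by (intro sum_mono) auto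
  also have "\<dots> \<le> norm (prime_exp_sum N \<beta>)" by (rule complex_Re_le_cmod)
  finally show ?thesis by simp
qed

text \<open>Reverse triangle inequality in the preceding identity: the diagonal part
  \<open>?A\<close> has \<pi>(Q) terms of size at most \<open>Q\<close>, and the other part is
  \<pi>(Q) times a sum that is large near 0.\<close>

lemma sum_norm_prime_exp_sum_fractions_ge:
  assumes "1 \<le> N" "Q \<le> N" "\<bar>\<beta>\<bar> \<le> 1 / (8 * real N)"
  shows "(\<Sum>(q, a)\<in>prime_fractions Q. norm (prime_exp_sum N (\<beta> + real a / real q))) \<ge>
    real (card (primes_upto Q)) * (real (card (primes_upto N)) / 2 - real Q)"
proof -
  let ?A = "\<Sum>q\<in>primes_upto Q. of_nat q * add_char (real q * \<beta>)"
  let ?k = "real (card (primes_upto Q))"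
  have "norm ?A \<le> (\<Sum>q\<in>primes_upto Q. real Q)"
    by (intro sum_norm_le) (auto simp: norm_mult primes_upto_def)
  then have A: "norm ?A \<le> ?k * real Q" by simp
  have "?k * (real (card (primes_upto N)) / 2) \<le> ?k * norm (prime_exp_sum N \<beta>)"
    using norm_prime_exp_sum_near_0[of N \<beta>] assms by (intro mult_left_mono) auto
  with A have "?k * (real (card (primes_upto N)) / 2 - real Q) \<le>
      norm (of_nat (card (primes_upto Q)) * prime_exp_sum N \<beta>) - norm ?A"
    by (simp add: norm_mult algebra_simps)
  also have "\<dots> \<le> norm (?A - of_nat (card (primes_upto Q)) * prime_exp_sum N \<beta>)"
    by (metis norm_triangle_ineq2 norm_minus_commute)
  also have "\<dots> = norm (\<Sum>(q, a)\<in>prime_fractions Q. prime_exp_sum N (\<beta> + real a / real q))"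
    using sum_prime_exp_sum_fractions[OF assms(2)] by simp
  also have "\<dots> \<le> (\<Sum>(q, a)\<in>prime_fractions Q. norm (prime_exp_sum N (\<beta> + real a / real q)))"
    by (intro sum_norm_le) auto
  finally show ?thesis .
qed

section \<open>Integration over disjoint arcs\<close>

text \<open>The difference is a r - b q over q r: a nonzero integer over a denominator of at most
  Q^2.\<close>

lemma prime_fractions_separated:
  assumes "(q, a) \<in> prime_fractions Q" "(r, b) \<in> prime_fractions Q" "(q, a) \<noteq> (r, b)"
  shows "\<bar>real a / real q - real b / real r\<bar> \<ge> 1 / (real Q)\<^sup>2"
proof -
  have qr: "prime q" "prime r" "1 \<le> a" "a < q" "1 \<le> b" "b < r" "q \<le> Q" "r \<le> Q"
    using assms by (auto simp: prime_fractions_def primes_upto_def)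
  have ne: "a * r \<noteq> b * q"
  proof
    assume eq: "a * r = b * q"
    then have "q dvd a * r" by simp
    \<comment> \<open>Since 0 < a < q, the first alternative is impossible; the second gives q = r,
      and then a = b, contradicting distinctness.\<close>
    then have "q dvd a \<or> q dvd r" using qr prime_dvd_mult_iff by blast
    then have "q = r"
      using qr by (metis dvd_imp_le less_le_trans not_less primes_dvd_imp_eq zero_less_one)
    with eq qr assms show False by auto
  qed
  then have "int a * int r - int b * int q \<noteq> 0"
    by (metis eq_iff_diff_eq_0 of_nat_eq_iff of_nat_mult)
  then have "\<bar>real_of_int (int a * int r - int b * int q)\<bar> \<ge> 1"
    by linarith
  then have num: "1 \<le> \<bar>real a * real r - real b * real q\<bar>" by simp
  have "real q * real r \<le> (real Q)\<^sup>2"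
    unfolding power2_eq_square using qr by (intro mult_mono) auto
  then have "1 / (real Q)\<^sup>2 \<le> 1 / (real q * real r)"
    using qr by (intro divide_left_mono) (auto intro!: mult_pos_pos)
  also have "\<dots> \<le> \<bar>real a * real r - real b * real q\<bar> / (real q * real r)"
    using num by (intro divide_right_mono) auto
  also have "\<dots> = \<bar>(real a * real r - real b * real q) / (real q * real r)\<bar>"
    by (simp add: abs_divide)
  also have "(real a * real r - real b * real q) / (real q * real r) = real a / real q - real b / real r"
    using qr by (simp add: field_simps)
  finally show ?thesis .
qed

text \<open>Keeps the arcs around the fractions inside the unit interval, so that no wrapping modulo
  1 is needed.\<close>

lemma prime_fractions_bounds:
  assumes "(q, a) \<in> prime_fractions Q"
  shows "1 / real Q \<le> real a / real q" "real a / real q \<le> 1 - 1 / real Q"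
proof -
  have qr: "1 \<le> a" "a < q" "q \<le> Q"
    using assms by (auto simp: prime_fractions_def primes_upto_def)
  have *: "1 / real Q \<le> 1 / real q" using qr by (intro divide_left_mono) auto
  also have "\<dots> \<le> real a / real q" using qr by (intro divide_right_mono) auto
  finally show "1 / real Q \<le> real a / real q" .
  have "real a / real q \<le> (real q - 1) / real q" using qr by (intro divide_right_mono) auto
  also have "\<dots> = 1 - 1 / real q" using qr by (simp add: field_simps)
  finally show "real a / real q \<le> 1 - 1 / real Q" using * by linarith
qed

text \<open>Translating each integral back to its own window turns the left side into one integral
  over a disjoint union inside \<open>{u..v}\<close>; nonnegativity of \<open>f\<close> allows the
  rest to be discarded.\<close>

lemma sum_integral_disjoint_intervals_le:
  fixes f :: "real \<Rightarrow> real" and x :: "'i \<Rightarrow> real"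
  assumes "finite I" "f integrable_on {u..v}" "\<And>t. t \<in> {u..v} \<Longrightarrow> f t \<ge> 0"
    and sub: "\<And>i. i \<in> I \<Longrightarrow> {x i - \<delta>..x i + \<delta>} \<subseteq> {u..v}"
    and sep: "\<And>i j. i \<in> I \<Longrightarrow> j \<in> I \<Longrightarrow> i \<noteq> j \<Longrightarrow> \<bar>x i - x j\<bar> > 2 * \<delta>"
  shows "(\<Sum>i\<in>I. integral {-\<delta>..\<delta>} (\<lambda>t. f (t + x i))) \<le> integral {u..v} f"
proof -
  have int: "(f has_integral integral {x i - \<delta>..x i + \<delta>} f) {x i - \<delta>..x i + \<delta>}"
    if "i \<in> I" for i
    using integrable_on_subinterval[OF assms(2) sub[OF that]] by (rule integrable_integral)
  have shift: "integral {-\<delta>..\<delta>} (\<lambda>t. f (t + x i)) = integral {x i - \<delta>..x i + \<delta>} f"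
    if "i \<in> I" for i
    using has_integral_shift_real_ivl[OF int[OF that], of "x i"]
    by (simp add: integral_unique)
  have "{x i - \<delta>..x i + \<delta>} \<inter> {x j - \<delta>..x j + \<delta>} = {}"
    if "i \<in> I" "j \<in> I" "i \<noteq> j" for i j
    using sep[OF that] by auto
  then have "pairwise (\<lambda>i j. negligible ({x i - \<delta>..x i + \<delta>} \<inter> {x j - \<delta>..x j + \<delta>})) I"
    by (simp add: pairwise_def)
  from has_integral_UN[OF assms(1) int this]
  have U: "(f has_integral (\<Sum>i\<in>I. integral {x i - \<delta>..x i + \<delta>} f)) (\<Union>i\<in>I. {x i - \<delta>..x i + \<delta>})"
    by simp
  have "(\<Sum>i\<in>I. integral {x i - \<delta>..x i + \<delta>} f) \<le> integral {u..v} f"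
    by (rule has_integral_subset_le[OF _ U integrable_integral[OF assms(2)]])
       (use sub assms(3) in blast)+
  then show ?thesis using shift by simp
qed

lemma integral_prime_exp_sum_ge:
  assumes "Q\<^sup>2 \<le> N" "1 \<le> Q"
  shows "integral {0..1} (\<lambda>t. norm (prime_exp_sum N t)) \<ge>
    real (card (primes_upto Q)) * (real (card (primes_upto N)) / 2 - real Q) / (4 * real N)"
proof -
  define \<delta> where "\<delta> = 1 / (8 * real N)"
  define f where "f = (\<lambda>t. norm (prime_exp_sum N t))"
  define x where "x = (\<lambda>(q :: nat, a :: nat). real a / real q)"
  define K where "K = real (card (primes_upto Q)) * (real (card (primes_upto N)) / 2 - real Q)"
  have QN: "Q \<le> N" using assms self_le_power[of Q 2] by linarith
  then have N: "N \<ge> 1" using assms by simp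
  have \<delta>: "\<delta> > 0" using N by (simp add: \<delta>_def)
  \<comment> \<open>The arc width 1/(4N) is below the minimal gap 1/Q^2 because Q^2 \<le> N; this
    gives disjointness.\<close>
  have "2 * \<delta> < 1 / real N" using N by (simp add: \<delta>_def field_simps)
  also have "\<dots> \<le> 1 / (real Q)\<^sup>2"
    using assms N by (intro divide_left_mono) (auto simp flip: of_nat_power)
  finally have \<delta>Q2: "2 * \<delta> < 1 / (real Q)\<^sup>2" .
  have "\<delta> \<le> 1 / real N" using N by (simp add: \<delta>_def field_simps)
  also have "\<dots> \<le> 1 / real Q" using QN assms by (intro divide_left_mono) auto
  finally have \<delta>Q: "\<delta> \<le> 1 / real Q" .
  have cont: "continuous_on S f" for S
    unfolding f_def by (intro continuous_intros continuous_on_prime_exp_sum)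
  have cont': "continuous_on S (\<lambda>t. f (t + y))" for S y
    by (rule continuous_on_compose2[OF cont[of UNIV]]) (auto intro!: continuous_intros)
  \<comment> \<open>The factor 1/(4N) is the length 2\<delta> of the range of \<beta>, over which
    the pointwise bound \<open>K\<close> is integrated.\<close>
  have "K / (4 * real N) = integral {-\<delta>..\<delta>} (\<lambda>t. K)"
    using \<delta> by (simp add: \<delta>_def)
  also have "\<dots> \<le> integral {-\<delta>..\<delta>} (\<lambda>t. \<Sum>i\<in>prime_fractions Q. f (t + x i))"
  proof (rule integral_le)
    show "(\<lambda>t. \<Sum>i\<in>prime_fractions Q. f (t + x i)) integrable_on {-\<delta>..\<delta>}"
      by (intro integrable_sum integrable_continuous_real cont') auto
    fix t assume "t \<in> {-\<delta>..\<delta>}"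
    then have "\<bar>t\<bar> \<le> 1 / (8 * real N)" by (auto simp: \<delta>_def)
    from sum_norm_prime_exp_sum_fractions_ge[OF N QN this]
    show "K \<le> (\<Sum>i\<in>prime_fractions Q. f (t + x i))"
      by (simp add: K_def f_def x_def case_prod_unfold)
  qed auto
  also have "\<dots> = (\<Sum>i\<in>prime_fractions Q. integral {-\<delta>..\<delta>} (\<lambda>t. f (t + x i)))"
    by (intro integral_sum integrable_continuous_real cont') auto
  also have "\<dots> \<le> integral {0..1} f"
  proof (rule sum_integral_disjoint_intervals_le)
    show "f integrable_on {0..1}" by (intro integrable_continuous_real cont)
    show "{x i - \<delta>..x i + \<delta>} \<subseteq> {0..1}" if "i \<in> prime_fractions Q" for i
    proof (cases i)
      case (Pair q a)
      with that prime_fractions_bounds[of q a Q] \<delta>Q show ?thesis by (auto simp: x_def)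
    qed
    show "\<bar>x i - x j\<bar> > 2 * \<delta>"
      if "i \<in> prime_fractions Q" "j \<in> prime_fractions Q" "i \<noteq> j" for i j
    proof (cases i, cases j)
      fix q a r b assume "i = (q, a)" "j = (r, b)"
      with that prime_fractions_separated[of q a Q r b] \<delta>Q2 show ?thesis by (auto simp: x_def)
    qed
  qed (auto simp: f_def)
  finally show ?thesis by (simp add: f_def K_def)
qed

section \<open>The Fourier bound for small N, and the final assembly\<close>

lemma integral_prime_exp_sum_ge_1:
  assumes "N \<ge> 2"
  shows "integral {0..1} (\<lambda>t. norm (prime_exp_sum N t)) \<ge> 1"
proof -
  \<comment> \<open>Orthogonality over a full period: only the frequency p - 2 = 0 survives.\<close>
  have coeff: "((\<lambda>t. cos (2 * pi * (real p - 2) * t)) has_integral (if p = 2 then 1 else 0)) {0..1}"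
    for p :: nat
  proof (cases "p = 2")
    case True
    then show ?thesis using has_integral_const_real[of "1::real" 0 1] by simp
  next
    case False
    define w where "w = 2 * pi * (real p - 2)"
    have w: "w \<noteq> 0" using False by (simp add: w_def)
    have "((\<lambda>t. cos (w * t)) has_integral (sin (w * 1) / w - sin (w * 0) / w)) {0..1}"
      using w by (intro fundamental_theorem_of_calculus)
        (auto intro!: derivative_eq_intros simp flip: has_real_derivative_iff_has_vector_derivative)
    moreover have "sin w = 0"
      unfolding w_def using sin_integer_2pi[of "real p - 2"] by (simp add: mult_ac)
    ultimately show ?thesis using False by (simp add: w_def)
  qed
  have "((\<lambda>t. \<Sum>p\<in>primes_upto N. cos (2 * pi * (real p - 2) * t)) has_integral
      (\<Sum>p\<in>primes_upto N. if p = 2 then 1 else 0)) {0..1}"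
    by (intro has_integral_sum coeff) auto
  moreover have "(\<Sum>p\<in>primes_upto N. if p = 2 then 1 else (0::real)) = 1"
    using assms by (simp add: primes_upto_def)
  ultimately have one: "((\<lambda>t. \<Sum>p\<in>primes_upto N. cos (2 * pi * (real p - 2) * t)) has_integral 1) {0..1}"
    by simp
  show ?thesis
  proof (rule has_integral_le[OF one integrable_integral])
    show "(\<lambda>t. norm (prime_exp_sum N t)) integrable_on {0..1}"
      by (intro integrable_continuous_real continuous_intros continuous_on_prime_exp_sum)
    fix t :: real
    \<comment> \<open>Twisting by the unimodular factor e(-2t) shifts each frequency p to p - 2 and
      leaves the norm unchanged.\<close>
    have "(\<Sum>p\<in>primes_upto N. cos (2 * pi * (real p - 2) * t)) =
        Re (prime_exp_sum N t * add_char (- 2 * t))"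
      unfolding prime_exp_sum_def sum_distrib_right Re_sum add_char_add[symmetric] Re_add_char
      by (simp add: algebra_simps)
    also have "\<dots> \<le> norm (prime_exp_sum N t * add_char (- 2 * t))" by (rule complex_Re_le_cmod)
    finally show "(\<Sum>p\<in>primes_upto N. cos (2 * pi * (real p - 2) * t)) \<le> norm (prime_exp_sum N t)"
      by (simp add: norm_mult)
  qed
qed

lemma eventually_integral_prime_exp_sum_ge:
  "eventually (\<lambda>N. integral {0..1} (\<lambda>t. norm (prime_exp_sum N t)) \<ge>
     1 / 1000 * (sqrt (real N) / (ln (real N))\<^sup>2)) sequentially"
proof -
  \<comment> \<open>N/(12 ln N) is half of the Chebyshev bound for \<pi>(N); the loss
    \<open>Q\<close> \<le> sqrt N eventually costs at most half of it.\<close>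
  have "eventually (\<lambda>N. real N / (12 * ln (real N)) - sqrt (real N) \<ge> real N / (24 * ln (real N)))
      sequentially"
    by real_asymp
  moreover have "eventually (\<lambda>N::nat. N \<ge> 4) sequentially" by (rule eventually_ge_at_top)
  ultimately show ?thesis
  proof eventually_elim
    case (elim N)
    define Q where "Q = nat \<lfloor>sqrt (real N)\<rfloor>"
    define L where "L = ln (real N)"
    have "sqrt (real N) \<ge> 2" using elim real_le_rsqrt[of 2 "real N"] by simp
    then have Q: "real Q \<le> sqrt (real N)" "sqrt (real N) / 2 \<le> real Q" "Q \<ge> 2"
      unfolding Q_def by linarith+
    have L: "L > 0" using elim by (simp add: L_def)
    have "(real Q)\<^sup>2 \<le> real N" using Q(1) by (metis of_nat_0_le_iff power_mono real_sqrt_pow2)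
    then have "Q\<^sup>2 \<le> N" by (metis of_nat_le_iff of_nat_power)
    have lnQ: "ln (real Q) \<le> L / 2"
    proof -
      have "ln (real Q) \<le> ln (sqrt (real N))" using Q elim by (subst ln_le_cancel_iff) auto
      then show ?thesis using elim by (simp add: L_def ln_sqrt)
    qed
    \<comment> \<open>The factor 2 lost in \<open>Q\<close> \<ge> sqrt N / 2 is regained from ln Q
      \<le> L/2.\<close>
    have "sqrt (real N) / (6 * L) = (sqrt (real N) / 2) / (6 * (L / 2))" by simp
    also have "\<dots> \<le> real Q / (6 * ln (real Q))"
      using Q lnQ L by (intro frac_le) auto
    also have "\<dots> \<le> real (card (primes_upto Q))" using card_primes_upto_ge Q by blast
    finally have 1: "sqrt (real N) / (6 * L) \<le> real (card (primes_upto Q))" .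
    have "real N / (24 * L) \<le> real N / (12 * L) - real Q"
      using elim(1) Q(1) unfolding L_def by linarith
    also have "\<dots> \<le> real (card (primes_upto N)) / 2 - real Q"
      using card_primes_upto_ge[of N] elim(2) by (simp add: L_def)
    finally have 2: "real N / (24 * L) \<le> real (card (primes_upto N)) / 2 - real Q" .
    \<comment> \<open>576 = 6 * 24 * 4 is the product of the three denominators; 1/1000 is a
      rounder, smaller constant.\<close>
    have "1 / 1000 * (sqrt (real N) / L\<^sup>2) \<le> 1 / 576 * (sqrt (real N) / L\<^sup>2)"
      by (intro mult_right_mono) auto
    also have "\<dots> = (sqrt (real N) / (6 * L)) * (real N / (24 * L)) / (4 * real N)"
      using L elim by (simp add: field_simps power2_eq_square)
    also have "\<dots> \<le> real (card (primes_upto Q)) * (real (card (primes_upto N)) / 2 - real Q) / (4 * real N)"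
      using 1 2 L by (intro divide_right_mono mult_mono) auto
    also have "\<dots> \<le> integral {0..1} (\<lambda>t. norm (prime_exp_sum N t))"
      using \<open>Q\<^sup>2 \<le> N\<close> Q by (intro integral_prime_exp_sum_ge) auto
    finally show ?case by (simp add: L_def)
  qed
qed

theorem theorem7:
  shows "\<exists>c::real. c > 0 \<and>
    (\<forall>N::nat. N \<ge> 2 \<longrightarrow>
      integral {0..1} (\<lambda>\<alpha>::real. norm (\<Sum>p | prime p \<and> p \<le> N. add_char (real p * \<alpha>)))
        \<ge> c * (sqrt (real N) / (ln (real N))\<^sup>2))"
proof -
  obtain M where M: "\<And>N. N \<ge> M \<Longrightarrow> integral {0..1} (\<lambda>t. norm (prime_exp_sum N t)) \<ge>
     1 / 1000 * (sqrt (real N) / (ln (real N))\<^sup>2)"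
    using eventually_integral_prime_exp_sum_ge unfolding eventually_sequentially by blast
  \<comment> \<open>The first entry serves N \<ge> M. The second makes the right-hand side at most 1
    for 2 \<le> N < M, where the bound 1 suffices; adding 1 to sqrt M keeps the denominator positive
    even for M = 0.\<close>
  define c where "c = min (1 / 1000) ((ln 2)\<^sup>2 / (sqrt (real M) + 1))"
  have "c > 0" by (simp add: c_def add_nonneg_pos)
  moreover have "integral {0..1} (\<lambda>t. norm (prime_exp_sum N t)) \<ge> c * (sqrt (real N) / (ln (real N))\<^sup>2)"
    if "N \<ge> 2" for N
  proof (cases "N \<ge> M")
    case True
    have "c * (sqrt (real N) / (ln (real N))\<^sup>2) \<le> 1 / 1000 * (sqrt (real N) / (ln (real N))\<^sup>2)"
      unfolding c_def by (intro mult_right_mono min.cobounded1) auto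
    with M[OF True] show ?thesis by linarith
  next
    case False
    have "sqrt (real N) / (ln (real N))\<^sup>2 \<le> (sqrt (real M) + 1) / (ln 2)\<^sup>2"
      using that False by (intro frac_le power_mono) (auto intro: order_trans[of _ "sqrt (real M)"])
    then have "c * (sqrt (real N) / (ln (real N))\<^sup>2) \<le>
        (ln 2)\<^sup>2 / (sqrt (real M) + 1) * ((sqrt (real M) + 1) / (ln 2)\<^sup>2)"
      using \<open>c > 0\<close> by (intro mult_mono) (auto simp: c_def)
    also have "\<dots> = 1"
    proof -
      have "sqrt (real M) + 1 > 0" by (simp add: add_nonneg_pos)
      then show ?thesis by simp
    qed
    finally show ?thesis using integral_prime_exp_sum_ge_1[OF that] by linarith
  qed
  ultimately show ?thesis unfolding prime_exp_sum_def primes_upto_def by blast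
qed

end
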